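(* Let $\mathbb F$ be an arbitrary field and let $W$ be an $n$-dimensional vector space over $\mathbb F$. Let $U_1,\ldots,U_m$ and $V_1,\ldots,V_m$ be subspaces of $W$ such that (i) $U_i\cap V_i=\{0\}$ for each $1\le i\le m$; (ii) $U_i\cap V_j\neq\{0\}$ whenever $1\le i<j\le m$. Then $m\le 2^n$. *)

theory Defs
  imports Complex_Main
begin

end

theory Submission
  imports Defs
begin

text \<open>
  The exterior algebra of \<open>W\<close> has dimension \<open>2 ^ n\<close>. Let \<open>x\<^sub>i\<close> and \<open>y\<^sub>i\<close> be the wedge products
  of bases of \<open>U\<^sub>i\<close> and \<open>V\<^sub>i\<close>. Then \<open>y\<^sub>j \<and> x\<^sub>i\<close> is zero exactly if \<open>U\<^sub>i\<close> and \<open>V\<^sub>j\<close> meet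
  nontrivially, so the matrix of products is triangular with nonzero diagonal, and the \<open>x\<^sub>i\<close> are
  linearly independent.

  The exterior algebra is built one basis vector \<open>b\<close> at a time as \<open>\<Lambda> \<oplus> b \<and> \<Lambda>\<close>; the
  only structure needed is left multiplication by vectors, together with contraction by a linear
  functional, which shows that wedge products of independent vectors do not vanish.
\<close>

subsection \<open>Left multiplication and contraction in coordinates\<close>

text \<open>
  An element \<open>p + b \<and> q\<close> is encoded by a function on \<open>nat\<close> whose values at even arguments are
  \<open>p\<close> and at odd arguments \<open>q\<close>. With \<open>d\<close> basis vectors, the algebra consists of the functions
  vanishing on \<open>{2 ^ d..}\<close>.
\<close>

fun wedge :: "('b \<Rightarrow> 'f::comm_ring_1) \<Rightarrow> 'b list \<Rightarrow> (nat \<Rightarrow> 'f) \<Rightarrow> nat \<Rightarrow> 'f" where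
  "wedge x [] g s = 0"
| "wedge x (b # bs) g s =
    (if even s then wedge x bs (\<lambda>t. g (2 * t)) (s div 2)
     else x b * g (2 * (s div 2)) - wedge x bs (\<lambda>t. g (2 * t + 1)) (s div 2))"

text \<open>The interior product with the functional whose values on the basis are \<open>c\<close>;
  the minus sign is that of an antiderivation passing \<open>b\<close>.\<close>

fun contract :: "('b \<Rightarrow> 'f::comm_ring_1) \<Rightarrow> 'b list \<Rightarrow> (nat \<Rightarrow> 'f) \<Rightarrow> nat \<Rightarrow> 'f" where
  "contract c [] g s = 0"
| "contract c (b # bs) g s =
    (if even s then contract c bs (\<lambda>t. g (2 * t)) (s div 2) + c b * g (2 * (s div 2) + 1)
     else - contract c bs (\<lambda>t. g (2 * t + 1)) (s div 2))"

text \<open>The unit of the algebra: the bits of an index record which basis vectors occur, so 0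
  stands for the empty product.\<close>

definition vacuum :: "nat \<Rightarrow> 'f::comm_ring_1" where
  "vacuum s = (if s = 0 then 1 else 0)"

section \<open>Bilinearity and anticommutation of left multiplication\<close>

lemma wedge_add_right: "wedge x bs (\<lambda>s. g s + h s) s = wedge x bs g s + wedge x bs h s"
  by (induction bs arbitrary: g h s) (auto simp: algebra_simps)

lemma wedge_scale_right: "wedge x bs (\<lambda>s. k * g s) s = k * wedge x bs g s"
  by (induction bs arbitrary: g s) (auto simp: algebra_simps)

lemma wedge_zero_right: "wedge x bs (\<lambda>_. 0) s = 0"
  using wedge_scale_right[of x bs 0 "\<lambda>_. 0"] by simp

lemma wedge_minus_right: "wedge x bs (\<lambda>s. - g s) s = - wedge x bs g s"
  using wedge_scale_right[of x bs "-1" g] by simp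

lemma wedge_add_left: "wedge (\<lambda>b. x b + y b) bs g s = wedge x bs g s + wedge y bs g s"
  by (induction bs arbitrary: g s) (auto simp: algebra_simps)

lemma wedge_scale_left: "wedge (\<lambda>b. k * x b) bs g s = k * wedge x bs g s"
  by (induction bs arbitrary: g s) (auto simp: algebra_simps)

lemma wedge_diff_right: "wedge x bs (\<lambda>s. g s - h s) s = wedge x bs g s - wedge x bs h s"
  using wedge_add_right[of x bs g "\<lambda>s. - h s"] by (simp add: wedge_minus_right)

lemma wedge_sum_right:
  "wedge x bs (\<lambda>s. \<Sum>i\<in>I. c i * g i s) s = (\<Sum>i\<in>I. c i * wedge x bs (g i) s)"
  by (induction I rule: infinite_finite_induct)
    (simp_all add: wedge_zero_right wedge_add_right wedge_scale_right)

text \<open>Split x into its \<open>b\<close>-component and a rest x'. The square of x' vanishes by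
  induction, and the sign in \<open>wedge\<close> cancels the two mixed terms.\<close>

lemma wedge_wedge_self: "wedge x bs (wedge x bs g) s = 0"
  by (induction bs arbitrary: g s)
    (simp_all add: wedge_diff_right wedge_scale_right del: odd_two_times_div_two_nat)

text \<open>Polarisation: the squares of x, y and x + y all vanish, so the two cross terms add up to
  zero.\<close>

lemma wedge_anticommute: "wedge x bs (wedge y bs g) s = - wedge y bs (wedge x bs g) s"
proof -
  have "0 = wedge (\<lambda>b. x b + y b) bs (wedge (\<lambda>b. x b + y b) bs g) s"
    by (simp add: wedge_wedge_self)
  also have "\<dots> = wedge x bs (wedge y bs g) s + wedge y bs (wedge x bs g) s"
    by (simp add: wedge_add_left[abs_def] wedge_add_right wedge_wedge_self)
  finally show ?thesis
    by (simp add: eq_neg_iff_add_eq_0)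
qed

lemma wedge_supported:
  assumes "\<And>s. s \<ge> 2 ^ length bs \<Longrightarrow> g s = 0" and "s \<ge> 2 ^ length bs"
  shows "wedge x bs g s = 0"
  using assms
proof (induction bs arbitrary: g s)
  case (Cons b bs)
  have "s div 2 \<ge> 2 ^ length bs"
    using Cons.prems(2) by simp
  moreover have "g (2 * t) = 0" "g (2 * t + 1) = 0" if "t \<ge> 2 ^ length bs" for t
    using that by (auto intro!: Cons.prems(1))
  ultimately show ?case
    using Cons.IH[of "\<lambda>t. g (2 * t)"] Cons.IH[of "\<lambda>t. g (2 * t + 1)"]
    by (simp del: odd_two_times_div_two_nat)
qed simp

section \<open>Contraction and its commutation relation with multiplication\<close>

lemma contract_add_right:
  "contract c bs (\<lambda>s. g s + h s) s = contract c bs g s + contract c bs h s"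
  by (induction bs arbitrary: g h s) (auto simp: algebra_simps)

lemma contract_scale_right: "contract c bs (\<lambda>s. k * g s) s = k * contract c bs g s"
  by (induction bs arbitrary: g s) (auto simp: algebra_simps)

lemma contract_diff_right:
  "contract c bs (\<lambda>s. g s - h s) s = contract c bs g s - contract c bs h s"
  using contract_add_right[of c bs g "\<lambda>s. - h s"] contract_scale_right[of c bs "-1" h] by simp

lemma contract_zero_right: "contract c bs (\<lambda>_. 0) s = 0"
  using contract_scale_right[of c bs 0 "\<lambda>_. 0"] by simp

lemma contract_vacuum: "contract c bs vacuum s = (0 :: 'f::comm_ring_1)"
proof (induction bs arbitrary: s)
  case (Cons b bs)
  have "(\<lambda>t. vacuum (2 * t) :: 'f) = vacuum" "(\<lambda>t. vacuum (2 * t + 1) :: 'f) = (\<lambda>_. 0)"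
    by (auto simp: vacuum_def)
  then show ?case
    using Cons.IH by (simp add: contract_zero_right) (simp add: vacuum_def)
qed simp

text \<open>The Clifford relation; the scalar on the right is the functional applied to the vector.
  After splitting off \<open>b\<close> the mixed terms cancel, leaving \<open>c b * x b\<close> and
  the induction hypothesis.\<close>

lemma contract_wedge:
  "contract c bs (wedge x bs g) s + wedge x bs (contract c bs g) s
    = (\<Sum>b\<leftarrow>bs. c b * x b) * g s"
proof (induction bs arbitrary: g s)
  case (Cons b bs)
  show ?case
  proof (cases "even s")
    case True
    then show ?thesis
      using Cons.IH[of "\<lambda>t. g (2 * t)" "s div 2"]
      by (simp add: wedge_add_right wedge_scale_right algebra_simps)
  next
    case False
    then have "Suc (2 * (s div 2)) = s"
      by presburger
    then show ?thesis
      using Cons.IH[of "\<lambda>t. g (2 * t + 1)" "s div 2"] False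
      by (simp add: contract_diff_right contract_scale_right wedge_minus_right algebra_simps
          del: odd_two_times_div_two_nat)
  qed
qed simp

subsection \<open>Wedge products of lists of vectors\<close>

definition (in vector_space) wedges :: "'b list \<Rightarrow> 'b list \<Rightarrow> (nat \<Rightarrow> 'a) \<Rightarrow> nat \<Rightarrow> 'a" where
  "wedges bs ws g = foldr (\<lambda>w. wedge (representation (set bs) w) bs) ws g"

context vector_space
begin

lemma wedges_simps [simp]:
  "wedges bs [] g = g"
  "wedges bs (w # ws) g = wedge (representation (set bs) w) bs (wedges bs ws g)"
  "wedges bs (vs @ ws) g = wedges bs vs (wedges bs ws g)"
  by (simp_all add: wedges_def)

lemma wedges_sum:
  "wedges bs ws (\<lambda>s. \<Sum>i\<in>I. c i * g i s) = (\<lambda>s. \<Sum>i\<in>I. c i * wedges bs ws (g i) s)"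
  by (induction ws) (simp_all add: wedge_sum_right[abs_def])

lemma wedges_zero: "wedges bs ws (\<lambda>_. 0) = (\<lambda>_. 0)"
  using wedges_sum[of bs ws "\<lambda>_. 0" _ "{}"] by simp

text \<open>Source of the bound: every product is determined by its first
  \<open>2 ^ length bs\<close> coordinates.\<close>

lemma wedges_vacuum_supported: "s \<ge> 2 ^ length bs \<Longrightarrow> wedges bs ws vacuum s = 0"
proof (induction ws arbitrary: s)
  case Nil
  then have "0 < s"
    by (meson less_le_trans zero_less_numeral zero_less_power)
  then show ?case
    by (simp add: vacuum_def)
qed (simp add: wedge_supported)

context
  fixes bs :: "'b list"
  assumes distinct_basis: "distinct bs"
    and independent_basis: "independent (set bs)"
    and span_basis: "span (set bs) = UNIV"
begin

text \<open>Anticommute \<open>w\<close> past the preceding factors until it meets its own copy,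
  where the square vanishes.\<close>

lemma wedge_wedges_member:
  "w \<in> set ws \<Longrightarrow> wedge (representation (set bs) w) bs (wedges bs ws g) = (\<lambda>_. 0)"
proof (induction ws)
  case (Cons v ws)
  show ?case
  proof (cases "w = v")
    case True
    then show ?thesis
      by (auto simp: wedge_wedge_self)
  next
    case False
    then have "wedge (representation (set bs) w) bs (wedges bs ws g) = (\<lambda>_. 0)"
      using Cons by simp
    then show ?thesis
      using wedge_anticommute[of "representation (set bs) w" bs "representation (set bs) v"]
      by (auto simp: wedge_zero_right)
  qed
qed simp

lemma wedge_wedges_span:
  assumes "w \<in> span (set ws)"
  shows "wedge (representation (set bs) w) bs (wedges bs ws g) = (\<lambda>_. 0)"
  using assms
proof (induction rule: span_induct_alt)
  case base
  show ?case
    using wedge_scale_left[of 0 "\<lambda>_. 0" bs] by (auto simp: representation_zero)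
next
  case (step k v w)
  then show ?case
    using wedge_wedges_member[of v ws g]
    by (auto simp: representation_add representation_scale independent_basis span_basis
        wedge_add_left wedge_scale_left)
qed

text \<open>Evaluates the scalar in \<open>contract_wedge\<close> when the contraction comes from a
  linear functional.\<close>

lemma sum_list_representation:
  assumes "Vector_Spaces.linear scale (*) f"
  shows "(\<Sum>b\<leftarrow>bs. f b * representation (set bs) w b) = f w"
proof -
  interpret f: Vector_Spaces.linear scale "(*)" f
    by fact
  have "f w = f (\<Sum>b\<in>set bs. representation (set bs) w b *s b)"
    by (subst sum_representation_eq) (simp_all add: independent_basis span_basis)
  also have "\<dots> = (\<Sum>b\<in>set bs. f b * representation (set bs) w b)"
    by (simp add: f.sum f.scale mult.commute)
  finally show ?thesis
    by (simp add: sum_list_distinct_conv_sum_set distinct_basis)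
qed

text \<open>Contraction passes each factor killed by \<open>f\<close> with only a change of sign,
  and finally annihilates the unit.\<close>

lemma contract_wedges:
  assumes f: "Vector_Spaces.linear scale (*) f" and "\<And>w. w \<in> set ws \<Longrightarrow> f w = 0"
  shows "contract f bs (wedges bs ws vacuum) = (\<lambda>_. 0)"
  using assms(2)
proof (induction ws)
  case Nil
  show ?case
    by (auto simp: contract_vacuum)
next
  case (Cons w ws)
  then show ?case
    using contract_wedge[of f bs "representation (set bs) w" "wedges bs ws vacuum"]
    by (auto simp: sum_list_representation[OF f] wedge_zero_right)
qed

text \<open>\<open>distinct\<close> matters because \<open>set ws\<close> forgets repetitions,
  whereas a repeated factor makes the product zero.\<close>

theorem wedges_vacuum_nonzero_iff:
  "wedges bs ws vacuum \<noteq> (\<lambda>_. 0) \<longleftrightarrow> distinct ws \<and> independent (set ws)"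
proof (induction ws)
  case Nil
  show ?case
    using independent_empty by (auto simp: vacuum_def fun_eq_iff)
next
  case (Cons w ws)
  show ?case
  proof (cases "distinct ws \<and> independent (set ws)")
    case False
    then have "wedges bs ws vacuum = (\<lambda>_. 0)"
      using Cons by blast
    moreover have "\<not> (distinct (w # ws) \<and> independent (set (w # ws)))"
      using False independent_mono[of "set (w # ws)" "set ws"] by auto
    ultimately show ?thesis
      by (auto simp: wedge_zero_right)
  next
    case indep: True
    show ?thesis
    proof (cases "w \<in> span (set ws)")
      case True
      then show ?thesis
        using wedge_wedges_span[OF True] by (auto simp: independent_insert)
    next
      case False
      then have "w \<notin> set ws"
        using span_base by blast
      have ind: "independent (insert w (set ws))"
        using False indep by (simp add: independent_insertI)
      interpret pair: vector_space_pair scale "(*) :: 'a \<Rightarrow> 'a \<Rightarrow> 'a"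
        by unfold_locales (simp_all add: algebra_simps)
      \<comment> \<open>Contracting with this \<open>f\<close> strips \<open>w\<close> off the
        product and returns the product of \<open>ws\<close>, which is nonzero by induction.\<close>
      obtain f where f: "Vector_Spaces.linear scale (*) f"
        and fw: "\<And>v. v \<in> insert w (set ws) \<Longrightarrow> f v = (if v = w then 1 else 0)"
        using pair.linear_independent_extend[OF ind, of "\<lambda>v. if v = w then 1 else 0"] by blast
      have "contract f bs (wedges bs ws vacuum) = (\<lambda>_. 0)"
        using fw \<open>w \<notin> set ws\<close> by (intro contract_wedges f) auto
      then have "contract f bs (wedges bs (w # ws) vacuum) = wedges bs ws vacuum"
        using contract_wedge[of f bs "representation (set bs) w" "wedges bs ws vacuum"] fw
        by (auto simp: sum_list_representation[OF f] wedge_zero_right)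
      moreover have "wedges bs ws vacuum \<noteq> (\<lambda>_. 0)"
        using Cons indep by simp
      ultimately have "wedges bs (w # ws) vacuum \<noteq> (\<lambda>_. 0)"
        by (metis contract_zero_right ext)
      then show ?thesis
        using ind indep \<open>w \<notin> set ws\<close> by simp
    qed
  qed
qed

end

text \<open>Turns nonvanishing of a concatenated product into a condition on the subspaces. When
  \<open>a\<close> is added to \<open>A\<close>, each side gains exactly the condition that
  \<open>a\<close> lies outside \<open>span (A \<union> C)\<close>.\<close>

lemma independent_Un_iff_span_Int:
  assumes "finite A" "independent A" "independent C"
  shows "A \<inter> C = {} \<and> independent (A \<union> C) \<longleftrightarrow> span A \<inter> span C = {0}"
  using assms
proof (induction A)
  case empty
  then show ?case
    by (auto simp: span_zero)
next
  case (insert a A)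
  have a: "a \<notin> span A" and IH: "A \<inter> C = {} \<and> independent (A \<union> C) \<longleftrightarrow> span A \<inter> span C = {0}"
    using insert by (auto simp: independent_insert)
  have "insert a A \<inter> C = {} \<and> independent (insert a A \<union> C)
      \<longleftrightarrow> (A \<inter> C = {} \<and> independent (A \<union> C)) \<and> a \<notin> span (A \<union> C)"
    using insert.hyps span_base[of a "A \<union> C"] by (auto simp: independent_insert)
  also have "\<dots> \<longleftrightarrow> span A \<inter> span C = {0} \<and> a \<notin> span (A \<union> C)"
    using IH by simp
  also have "\<dots> \<longleftrightarrow> span (insert a A) \<inter> span C = {0}"
  proof safe
    fix z assume AC: "span A \<inter> span C = {0}" and aAC: "a \<notin> span (A \<union> C)"
      and z: "z \<in> span (insert a A)" "z \<in> span C"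
    obtain k where k: "z - k *s a \<in> span A"
      using z by (auto simp: span_breakdown_eq)
    \<comment> \<open>A nonzero \<open>k\<close> could be inverted, which would put \<open>a\<close>
      itself into this span.\<close>
    have "z - (z - k *s a) \<in> span (A \<union> C)"
      using k z(2) by (meson span_diff span_mono subsetD sup_ge1 sup_ge2)
    then have "k *s a \<in> span (A \<union> C)"
      by simp
    then have "inverse k *s (k *s a) \<in> span (A \<union> C)"
      by (rule span_scale)
    then have "k = 0"
      using aAC by (cases "k = 0") auto
    then show "z = 0"
      using k z AC by auto
  next
    assume AC: "span (insert a A) \<inter> span C = {0}" and "a \<in> span (A \<union> C)"
    \<comment> \<open>Here y = a - x lies in both spans, so it is 0, and then a = x contradicts the
      independence of \<open>insert a A\<close>.\<close>
    then obtain x y where xy: "a = x + y" "x \<in> span A" "y \<in> span C"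
      by (auto simp: span_Un)
    have "x \<in> span (insert a A)" "a \<in> span (insert a A)"
      using xy(2) span_mono[of A "insert a A"] by (auto intro: span_base)
    then have "a - x \<in> span (insert a A)"
      using span_diff by blast
    then have "y = 0"
      using xy AC by auto
    then show False
      using xy a by simp
  next
    fix z assume "span (insert a A) \<inter> span C = {0}" "z \<in> span A" "z \<in> span C"
    then show "z = 0"
      using span_mono[of A "insert a A"] by auto
  qed (auto simp: span_zero)
  finally show ?case .
qed

end

subsection \<open>Homogeneous linear systems\<close>

text \<open>Gaussian elimination: each equation \<open>t\<close> with a nonzero coefficient is used
  to eliminate one unknown \<open>p\<close>.\<close>

lemma homogeneous_system_nontrivial:
  fixes a :: "'i \<Rightarrow> 's \<Rightarrow> 'f::field"
  assumes "finite S" "finite I" "card S < card I"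
  shows "\<exists>c. (\<exists>i\<in>I. c i \<noteq> 0) \<and> (\<forall>s\<in>S. (\<Sum>i\<in>I. c i * a i s) = 0)"
  using assms
proof (induction S arbitrary: I a)
  case empty
  then have "I \<noteq> {}"
    by auto
  then show ?case
    by (intro exI[of _ "\<lambda>_. 1"]) auto
next
  case (insert t S)
  show ?case
  proof (cases "\<exists>p\<in>I. a p t \<noteq> 0")
    case False
    obtain c where "\<exists>i\<in>I. c i \<noteq> 0" "\<forall>s\<in>S. (\<Sum>i\<in>I. c i * a i s) = 0"
      using insert.IH[of I a] insert.prems insert.hyps by auto
    then show ?thesis
      using False by (intro exI[of _ c]) auto
  next
    case True
    then obtain p where p: "p \<in> I" "a p t \<noteq> 0"
      by blast
    define J where "J = I - {p}"
    have J: "finite J" "p \<notin> J" "I = insert p J" "card S < card J"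
      using p insert.prems insert.hyps by (auto simp: J_def)
    obtain c where c: "\<exists>i\<in>J. c i \<noteq> 0"
      "\<forall>s\<in>S. (\<Sum>i\<in>J. c i * (a i s - a i t / a p t * a p s)) = 0"
      using insert.IH[of J "\<lambda>i s. a i s - a i t / a p t * a p s"] J by blast
    \<comment> \<open>The value of the unknown \<open>p\<close> that solves equation
      \<open>t\<close>, given the others.\<close>
    define q where "q = - (\<Sum>i\<in>J. c i * a i t / a p t)"
    have sum_I: "(\<Sum>i\<in>I. (c(p := q)) i * a i s)
        = (\<Sum>i\<in>J. c i * (a i s - a i t / a p t * a p s))" for s
    proof -
      have "(\<Sum>i\<in>I. (c(p := q)) i * a i s) = q * a p s + (\<Sum>i\<in>J. c i * a i s)"
        using J by (auto intro!: sum.cong)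
      also have "\<dots> = (\<Sum>i\<in>J. c i * (a i s - a i t / a p t * a p s))"
        by (simp add: q_def right_diff_distrib sum_subtractf sum_distrib_right mult.assoc)
      finally show ?thesis .
    qed
    have "\<forall>s\<in>insert t S. (\<Sum>i\<in>I. (c(p := q)) i * a i s) = 0"
      unfolding sum_I using c(2) p(2) by simp
    moreover have "\<exists>i\<in>I. (c(p := q)) i \<noteq> 0"
      using c(1) J by auto
    ultimately show ?thesis
      by blast
  qed
qed

subsection \<open>The skew Bollobas theorem for subspaces\<close>

theorem theorem1p6:
  fixes scale :: "'f::field \<Rightarrow> 'w::ab_group_add \<Rightarrow> 'w"
    and B :: "'w set"
    and U V :: "nat \<Rightarrow> 'w set"
    and m n :: nat
  assumes "finite_dimensional_vector_space scale B"
    and "vector_space.dim scale (UNIV :: 'w set) = n"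
    and "\<And>i. i \<in> {1..m} \<Longrightarrow> module.subspace scale (U i)"
    and "\<And>i. i \<in> {1..m} \<Longrightarrow> module.subspace scale (V i)"
    and "\<And>i. i \<in> {1..m} \<Longrightarrow> U i \<inter> V i = {0}"
    and "\<And>i j. 1 \<le> i \<Longrightarrow> i < j \<Longrightarrow> j \<le> m \<Longrightarrow> U i \<inter> V j \<noteq> {0}"
  shows "m \<le> 2 ^ n"
proof (rule ccontr)
  assume "\<not> m \<le> 2 ^ n"
  interpret finite_dimensional_vector_space scale B
    by fact
  obtain bs where bs: "set bs = B" "distinct bs"
    using finite_distinct_list[OF finite_Basis] by blast
  have basis: "distinct bs" "independent (set bs)" "span (set bs) = UNIV"
    using bs independent_Basis span_Basis by auto
  have len: "length bs = n"
    using assms(2) bs distinct_card[of bs] by simp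
  have basis_list: "\<exists>ws. distinct ws \<and> independent (set ws) \<and> span (set ws) = S"
    if S: "subspace S" for S
  proof -
    obtain A where A: "A \<subseteq> S" "independent A" "S \<subseteq> span A"
      using maximal_independent_subset by blast
    then have "span A = S"
      using S span_minimal by blast
    moreover obtain ws where "set ws = A" "distinct ws"
      using finite_distinct_list[OF finiteI_independent[OF A(2)]] by blast
    ultimately show ?thesis
      using A(2) by blast
  qed
  obtain us where us: "\<And>i. i \<in> {1..m} \<Longrightarrow>
      distinct (us i) \<and> independent (set (us i)) \<and> span (set (us i)) = U i"
    using basis_list[OF assms(3)] by metis
  obtain vs where vs: "\<And>i. i \<in> {1..m} \<Longrightarrow>
      distinct (vs i) \<and> independent (set (vs i)) \<and> span (set (vs i)) = V i"
    using basis_list[OF assms(4)] by metis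
  define x where "x i = wedges bs (us i) vacuum" for i
  have nonzero_iff: "wedges bs (vs j) (x i) \<noteq> (\<lambda>_. 0) \<longleftrightarrow> U i \<inter> V j = {0}"
    if ij: "i \<in> {1..m}" "j \<in> {1..m}" for i j
  proof -
    have "wedges bs (vs j) (x i) \<noteq> (\<lambda>_. 0)
        \<longleftrightarrow> set (vs j) \<inter> set (us i) = {} \<and> independent (set (vs j) \<union> set (us i))"
      using wedges_vacuum_nonzero_iff[OF basis, of "vs j @ us i"] us[OF ij(1)] vs[OF ij(2)]
      by (auto simp: x_def)
    also have "\<dots> \<longleftrightarrow> U i \<inter> V j = {0}"
      using independent_Un_iff_span_Int[of "set (vs j)" "set (us i)"] us[OF ij(1)] vs[OF ij(2)]
      by (auto simp: Int_commute)
    finally show ?thesis .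
  qed
  \<comment> \<open>More than \<open>2 ^ n\<close> vectors with \<open>2 ^ n\<close> relevant
    coordinates satisfy a nontrivial linear relation.\<close>
  obtain c where c: "\<exists>i\<in>{1..m}. c i \<noteq> 0" "\<forall>s\<in>{..<2 ^ n}. (\<Sum>i\<in>{1..m}. c i * x i s) = 0"
    using homogeneous_system_nontrivial[of "{..<2 ^ n :: nat}" "{1..m}" x] \<open>\<not> m \<le> 2 ^ n\<close> by auto
  have x_sum: "(\<lambda>s. \<Sum>i\<in>{1..m}. c i * x i s) = (\<lambda>_. 0)"
  proof
    fix s show "(\<Sum>i\<in>{1..m}. c i * x i s) = 0"
      using c(2) wedges_vacuum_supported[of bs s] len by (cases "s < 2 ^ n") (auto simp: x_def)
  qed
  \<comment> \<open>Multiplying the relation by the product of \<open>vs k\<close> leaves only term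
    \<open>k\<close>: those with i < k die by the skew condition, those with i > k by maximality of
    \<open>k\<close>.\<close>
  define k where "k = Max {i \<in> {1..m}. c i \<noteq> 0}"
  have "k \<in> {i \<in> {1..m}. c i \<noteq> 0}"
    unfolding k_def using c(1) by (intro Max_in) auto
  then have k: "k \<in> {1..m}" "c k \<noteq> 0"
    by auto
  have above_k: "c i = 0" if "i \<in> {1..m}" "k < i" for i
    using that Max_ge[of "{i \<in> {1..m}. c i \<noteq> 0}" i] by (fastforce simp: k_def)
  have "c k * wedges bs (vs k) (x k) s = 0" for s
  proof -
    have others: "c i * wedges bs (vs k) (x i) s = 0" if i: "i \<in> {1..m} - {k}" for i
    proof (cases "i < k")
      case True
      then have "wedges bs (vs k) (x i) = (\<lambda>_. 0)"
        using nonzero_iff[of i k] assms(6)[of i k] i k(1) by auto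
      then show ?thesis
        by simp
    next
      case False
      then show ?thesis
        using above_k[of i] i by auto
    qed
    have "0 = (\<Sum>i\<in>{1..m}. c i * wedges bs (vs k) (x i) s)"
      using fun_cong[OF wedges_sum[of bs "vs k" c x "{1..m}"], of s]
      unfolding x_sum wedges_zero by simp
    also have "\<dots> = c k * wedges bs (vs k) (x k) s"
      using k(1) others by (subst sum.remove[of _ k]) (auto simp: sum.neutral)
    finally show ?thesis
      by simp
  qed
  then have "wedges bs (vs k) (x k) = (\<lambda>_. 0)"
    using k(2) by auto
  then show False
    using nonzero_iff[OF k(1) k(1)] assms(5)[OF k(1)] by simp
qed

end
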